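(* Let $Y=B+W\in\mathbb{R}^{n\times n}$, where $W$ is a symmetric matrix with i.i.d. $\mathcal{N}(0,\sigma^2)$ entries on and above the diagonal. Let the true node support be $I_\star=[m]$, and let $$B_{ij}=\begin{cases}0&\text{if } i,j\in[m]\text{ or } i,j\in[m]^c,\\ \beta_1&\text{if } i=m+1,\ j\in[m]\ \text{ or }\ i\in[m],\ j=m+1,\\ \beta_2&\text{if } i\in[m],\ j\in[m+1]^c\ \text{ or }\ j\in[m],\ i\in[m+1]^c,\end{cases}$$ where $\beta_2=C\sigma n^{-1/4}\log^{1/4}n$ for some constant $C$ sufficiently large. Then, whenever $$\beta_1\ge C\sigma\,\frac{(n\log n)^{1/4}}{\sqrt m}$$ for some constant $C$ sufficiently large, both the overlapping group Lasso and the top-$m$ hard-thresholding approach, applied to $Y$, fail to recover the true support with high probability; that is, with probability tending to $1$ as $n\to\infty$, the set selected by the group Lasso is not equal to $I_\star$ for any regularization parameter $\lambda>0$, and the set selected by top-$m$ hard thresholding is not equal to $I_\star$.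
   Context: $[m]=\{1,\dots,m\}$ and complements are taken in $[n]$. The two displayed constants $C$ may differ. Overlapping group Lasso applied to $Y=(y_{ij})$ with parameter $\lambda$: minimize over $V=(v_{ij})\in\mathbb{R}^{n\times n}$ $$\frac12\sum_{1\le i\le j\le n}(y_{ij}-v_{ij}-v_{ji})^2+\lambda\sum_{i=1}^n\Bigl(\sum_{j=1}^nv_{ij}^2\Bigr)^{1/2}.$$ With $\alpha_i=(\sum_jv_{ij}^2)^{1/2}$ computed at the solution, it selects node $i$ if and only if $\alpha_i>0$. Top-$m$ hard thresholding applied to $Y$: select the $m$ indices $i$ with the largest row norms $\|Y_{i,\cdot}\|_2$.
   Formalization: The formal statement assumes m ≥ 2 (and m+1 ≤ n, so that row m+1 exists); for m = 1 the claim is false, since row 1 then has larger norm than row 2 and top-1 hard thresholding recovers {1} with probability tending to 1. *)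

theory Defs
  imports "HOL-Probability.Probability"
begin

(* An n x n matrix is a function A :: nat => nat => real of which only the entries with
   indices in {1..n} matter; L2_set (A i) {1..n} is the Euclidean norm of its i-th row. *)

definition signal_matrix :: "nat \<Rightarrow> real \<Rightarrow> real \<Rightarrow> nat \<Rightarrow> nat \<Rightarrow> real" where
  "signal_matrix m \<beta>1 \<beta>2 i j =
     (if i \<in> {1..m} \<and> j \<in> {1..m} \<or> i \<notin> {1..m} \<and> j \<notin> {1..m} then 0
      else if i = m + 1 \<and> j \<in> {1..m} \<or> i \<in> {1..m} \<and> j = m + 1 then \<beta>1
      else \<beta>2)"

definition symmetric_gaussian_noise ::
    "'a measure \<Rightarrow> nat \<Rightarrow> real \<Rightarrow> (nat \<Rightarrow> nat \<Rightarrow> 'a \<Rightarrow> real) \<Rightarrow> bool" where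
  "symmetric_gaussian_noise M n \<sigma> W \<longleftrightarrow>
     prob_space M \<and>
     (\<forall>i\<in>{1..n}. \<forall>j\<in>{1..n}. \<forall>\<omega>\<in>space M. W i j \<omega> = W j i \<omega>) \<and>
     prob_space.indep_vars M (\<lambda>_. borel) (\<lambda>(i, j). W i j) {(i, j). 1 \<le> i \<and> i \<le> j \<and> j \<le> n} \<and>
     (\<forall>i j. 1 \<le> i \<and> i \<le> j \<and> j \<le> n \<longrightarrow> distributed M lborel (W i j) (normal_density 0 \<sigma>))"

definition group_lasso_objective ::
    "nat \<Rightarrow> real \<Rightarrow> (nat \<Rightarrow> nat \<Rightarrow> real) \<Rightarrow> (nat \<Rightarrow> nat \<Rightarrow> real) \<Rightarrow> real" where
  "group_lasso_objective n l Y V =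
     1 / 2 * (\<Sum>i = 1..n. \<Sum>j = i..n. (Y i j - V i j - V j i)\<^sup>2)
     + l * (\<Sum>i = 1..n. L2_set (V i) {1..n})"

(* The minimizer is not assumed to be unique: this is a relation between the data Y and
   any set selected by some solution. *)
definition group_lasso_selects ::
    "nat \<Rightarrow> real \<Rightarrow> (nat \<Rightarrow> nat \<Rightarrow> real) \<Rightarrow> nat set \<Rightarrow> bool" where
  "group_lasso_selects n l Y S \<longleftrightarrow>
     (\<exists>V. is_arg_min (group_lasso_objective n l Y) (\<lambda>_. True) V \<and>
          S = {i \<in> {1..n}. L2_set (V i) {1..n} > 0})"

(* If there are ties among the row norms, every way of breaking them is admitted. *)
definition hard_threshold_selects ::
    "nat \<Rightarrow> nat \<Rightarrow> (nat \<Rightarrow> nat \<Rightarrow> real) \<Rightarrow> nat set \<Rightarrow> bool" where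
  "hard_threshold_selects n m Y S \<longleftrightarrow>
     S \<subseteq> {1..n} \<and> card S = m \<and>
     (\<forall>i\<in>S. \<forall>j\<in>{1..n} - S. L2_set (Y j) {1..n} \<le> L2_set (Y i) {1..n})"

(* The event may involve an uncountable family of conditions, so its probability is taken
   from inside, through measurable subsets; for measurable events this is the usual notion. *)
definition with_high_probability ::
    "(nat \<Rightarrow> 'a measure) \<Rightarrow> (nat \<Rightarrow> 'a \<Rightarrow> bool) \<Rightarrow> bool" where
  "with_high_probability M P \<longleftrightarrow>
     (\<exists>A. (\<forall>n. A n \<in> sets (M n) \<and> (\<forall>\<omega>\<in>A n. P n \<omega>)) \<and>
          (\<lambda>n. measure (M n) (A n)) \<longlonglongrightarrow> 1)"

end

(* Call Q_i = sum_j c_j * y_ij^2, with c_j = 4 for j = i and c_j = 1 otherwise, the energy of row i;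
   the factor 4 arises because v_ii enters the squared loss twice.

   Group Lasso, deterministic part. Put alpha_i = ||V_i|| and r_ij = y_ij - v_ij - v_ji at a solution,
   and g_ij = r_ij off the diagonal, g_ii = 2 r_ii. Stationarity in row i reads
   lambda * v_ij = g_ij * alpha_i, with ||g_i|| = lambda if row i is active and ||g_i|| <= lambda
   otherwise. Eliminating V gives r_ij = lambda * y_ij / (lambda + alpha_i + alpha_j) for i ~= j and
   r_ii = lambda * y_ii / (lambda + 4 * alpha_i). If k maximizes alpha and row i is inactive, then
   Q_i <= (lambda + alpha_k)^2 <= Q_k, whatever lambda is. So the Lasso cannot select [m] as soon as
   row m+1 has larger energy than every row of [m]; hard thresholding cannot do so either, where the
   same comparison is made with all c_j = 1.

   Probabilistic part. The signal contributes m * beta1^2 to row m+1 but only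
   beta1^2 + (n-m-1) * beta2^2 to a row of [m], and the difference dominates
   sigma^2 * sqrt(n log n), the uniform fluctuation of the n row energies. The latter is controlled
   by Chernoff's bound for weighted sums of non-centred Gaussian squares. *)

theory Submission
  imports Defs "HOL-Real_Asymp.Real_Asymp"
begin

subsection \<open>Stationarity of the group Lasso\<close>

(* The group Lasso forces the comparison with d = 4, hard thresholding the one with d = 1. *)
definition row_energy :: "real \<Rightarrow> nat \<Rightarrow> (nat \<Rightarrow> nat \<Rightarrow> real) \<Rightarrow> nat \<Rightarrow> real" where
  "row_energy d n Y i = (\<Sum>j = 1..n. (if j = i then d else 1) * (Y i j)\<^sup>2)"

text \<open>Each unordered pair {i, j} meets the triangle a \<le> b exactly once. This serves to
  evaluate the change of the squared loss when only row \<open>i\<close> of \<open>V\<close>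
  moves.\<close>

lemma sum_upper_triangle_one_row:
  fixes f :: "nat \<Rightarrow> nat \<Rightarrow> real"
  assumes i: "i \<in> {1..n}"
    and sym: "\<And>a b. f a b = f b a"
    and zero: "\<And>a b. a \<noteq> i \<Longrightarrow> b \<noteq> i \<Longrightarrow> f a b = 0"
  shows "(\<Sum>a = 1..n. \<Sum>b = a..n. f a b) = (\<Sum>j = 1..n. f i j)"
proof -
  have "(\<Sum>b = a..n. f a b) = (if a = i then \<Sum>b = i..n. f i b else 0) + (if a < i then f i a else 0)"
    if "a \<in> {1..n}" for a
  proof (cases "a = i")
    case False
    have "(\<Sum>b = a..n. f a b) = (\<Sum>b = a..n. if b = i then f a i else 0)"
      using zero False by (intro sum.cong) auto
    then show ?thesis using i False sym by auto
  qed simp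
  then have "(\<Sum>a = 1..n. \<Sum>b = a..n. f a b) =
      (\<Sum>a = 1..n. (if a = i then \<Sum>b = i..n. f i b else 0) + (if a < i then f i a else 0))"
    by simp
  also have "\<dots> = (\<Sum>b = i..n. f i b) + (\<Sum>a = 1..n. if a < i then f i a else 0)"
    using i by (simp add: sum.distrib)
  also have "(\<Sum>a = 1..n. if a < i then f i a else 0) = (\<Sum>a = 1..<i. f i a)"
    using i by (intro sum.mono_neutral_cong_right) auto
  also have "(\<Sum>b = i..n. f i b) + (\<Sum>a = 1..<i. f i a) = (\<Sum>j = 1..n. f i j)"
    using i by (subst sum.union_disjoint[symmetric]) (auto intro!: sum.cong)
  finally show ?thesis .
qed

text \<open>First-order optimality without derivatives: divide by \<open>t\<close> and let
  \<open>t\<close> tend to 0.\<close>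

lemma nonpos_if_linear_le_quadratic:
  fixes a c :: real
  assumes "\<And>t. t > 0 \<Longrightarrow> t * a \<le> c * t\<^sup>2"
  shows "a \<le> 0"
proof (rule ccontr)
  assume "\<not> a \<le> 0"
  then have a: "a > 0" by simp
  \<comment> \<open>Chosen so that (|c| + 1) * t = a / 2; the added 1 keeps the denominator positive
    when \<open>c\<close> is 0.\<close>
  define t where "t = a / (2 * (\<bar>c\<bar> + 1))"
  have t: "t > 0" using a by (simp add: t_def)
  have "a \<le> c * t" using assms[OF t] t by (simp add: power2_eq_square)
  also have "\<dots> \<le> (\<bar>c\<bar> + 1) * t" using t by (intro mult_right_mono) auto
  also have "\<dots> = a / 2" by (simp add: t_def add_nonneg_eq_0_iff divide_simps)
  finally show False using a by simp
qed

locale lasso_solution =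
  fixes n :: nat and l :: real and Y V :: "nat \<Rightarrow> nat \<Rightarrow> real"
  assumes l_pos: "l > 0"
    and Y_sym: "\<And>i j. i \<in> {1..n} \<Longrightarrow> j \<in> {1..n} \<Longrightarrow> Y i j = Y j i"
    and minimal: "is_arg_min (group_lasso_objective n l Y) (\<lambda>_. True) V"
begin

definition \<alpha> :: "nat \<Rightarrow> real" where
  "\<alpha> i = L2_set (V i) {1..n}"

definition residual :: "nat \<Rightarrow> nat \<Rightarrow> real" where
  "residual i j = Y i j - V i j - V j i"

text \<open>Minus the partial derivative of the squared loss in the entry (i, j) of
  \<open>V\<close>; the 2 appears because \<open>V i i\<close> is subtracted twice.\<close>

definition dual :: "nat \<Rightarrow> nat \<Rightarrow> real" where
  "dual i j = (if j = i then 2 else 1) * residual i j"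

lemma residual_sym: "i \<in> {1..n} \<Longrightarrow> j \<in> {1..n} \<Longrightarrow> residual i j = residual j i"
  using Y_sym by (simp add: residual_def)

lemma \<alpha>_nonneg: "\<alpha> i \<ge> 0"
  by (simp add: \<alpha>_def L2_set_nonneg)

text \<open>Optimality tested against a move along \<open>t * h\<close> in row \<open>i\<close>
  alone. The loss is expanded, but the norm is left as it stands because it is not differentiable at
  a zero row.\<close>

lemma row_perturbation:
  assumes i: "i \<in> {1..n}"
  shows "t * (\<Sum>j = 1..n. dual i j * h j)
    \<le> t\<^sup>2 * (\<Sum>j = 1..n. 2 * (h j)\<^sup>2) + l * (L2_set (\<lambda>j. V i j + t * h j) {1..n} - \<alpha> i)"
proof -
  define U where "U = (\<lambda>a b. if a = i then V i b + t * h b else V a b)"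
  define f where "f a b = (if a \<in> {1..n} \<and> b \<in> {1..n} then
      (Y a b - U a b - U b a)\<^sup>2 - (Y a b - V a b - V b a)\<^sup>2 else 0)" for a b
  have f_sym: "f a b = f b a" for a b
    using Y_sym[of a b] by (simp add: f_def algebra_simps)
  have f_zero: "f a b = 0" if "a \<noteq> i" "b \<noteq> i" for a b
    using that by (simp add: f_def U_def)
  have "0 \<le> group_lasso_objective n l Y U - group_lasso_objective n l Y V"
    using minimal by (simp add: is_arg_min_linorder)
  also have "\<dots> = 1 / 2 * (\<Sum>a = 1..n. \<Sum>b = a..n. f a b)
      + l * ((\<Sum>a = 1..n. L2_set (U a) {1..n}) - (\<Sum>a = 1..n. L2_set (V a) {1..n}))"
    unfolding group_lasso_objective_def
    by (simp add: f_def sum_subtractf algebra_simps cong: sum.cong_simp)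
  also have "(\<Sum>a = 1..n. \<Sum>b = a..n. f a b) = (\<Sum>j = 1..n. f i j)"
    by (rule sum_upper_triangle_one_row[OF i f_sym f_zero])
  also have "\<dots> = (\<Sum>j = 1..n. - 2 * t * (dual i j * h j) + t\<^sup>2 * (if j = i then 4 * (h j)\<^sup>2 else (h j)\<^sup>2))"
    using i by (intro sum.cong)
      (auto simp: f_def U_def dual_def residual_def algebra_simps power2_eq_square)
  \<comment> \<open>Only the diagonal term has coefficient 4; using 4 everywhere is harmless, since
    terms of order t^2 vanish in the limit.\<close>
  also have "\<dots> \<le> (\<Sum>j = 1..n. - 2 * t * (dual i j * h j) + t\<^sup>2 * (4 * (h j)\<^sup>2))"
    by (intro sum_mono add_left_mono mult_left_mono) auto
  also have "\<dots> = - 2 * (t * (\<Sum>j = 1..n. dual i j * h j)) + 2 * (t\<^sup>2 * (\<Sum>j = 1..n. 2 * (h j)\<^sup>2))"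
    by (simp add: sum.distrib sum_distrib_left sum_negf sum_subtractf mult_ac)
  also have "(\<Sum>a = 1..n. L2_set (U a) {1..n}) - (\<Sum>a = 1..n. L2_set (V a) {1..n})
      = L2_set (\<lambda>j. V i j + t * h j) {1..n} - \<alpha> i"
  proof -
    have "(\<Sum>a = 1..n. L2_set (U a) {1..n} - L2_set (V a) {1..n})
        = (\<Sum>a = 1..n. if a = i then L2_set (U a) {1..n} - L2_set (V a) {1..n} else 0)"
      by (intro sum.cong) (auto simp: U_def)
    also have "\<dots> = L2_set (U i) {1..n} - L2_set (V i) {1..n}" using i by simp
    also have "U i = (\<lambda>j. V i j + t * h j)" by (auto simp: U_def)
    finally show ?thesis by (simp add: sum_subtractf \<alpha>_def)
  qed
  finally have "0 \<le> 1 / 2 * (- 2 * (t * (\<Sum>j = 1..n. dual i j * h j)) + 2 * (t\<^sup>2 * (\<Sum>j = 1..n. 2 * (h j)\<^sup>2)))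
      + l * (L2_set (\<lambda>j. V i j + t * h j) {1..n} - \<alpha> i)" by simp
  then show ?thesis by argo
qed

text \<open>At a nonzero row the norm is differentiable with gradient
  \<open>V i j / \<alpha> i\<close>, which must balance the gradient of the loss. A quadratic upper
  bound on the norm replaces the derivative.\<close>

lemma stationarity_active:
  assumes i: "i \<in> {1..n}" and act: "\<alpha> i > 0" and j: "j \<in> {1..n}"
  shows "dual i j * \<alpha> i = l * V i j"
proof -
  (* h is the violation of stationarity, hence a descent direction unless it vanishes. *)
  define h where "h k = dual i k - l * V i k / \<alpha> i" for k
  let ?H = "\<Sum>k = 1..n. (h k)\<^sup>2" and ?vh = "\<Sum>k = 1..n. V i k * h k"
  have "t * ?H \<le> (2 * ?H + l * ?H / (2 * \<alpha> i)) * t\<^sup>2" if "t > 0" for t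
  proof -
    let ?N = "L2_set (\<lambda>k. V i k + t * h k) {1..n}"
    have "?N\<^sup>2 = (\<Sum>k = 1..n. (V i k + t * h k)\<^sup>2)"
      by (simp add: L2_set_def sum_nonneg)
    also have "\<dots> = (\<Sum>k = 1..n. (V i k)\<^sup>2) + 2 * t * ?vh + t\<^sup>2 * ?H"
      by (simp add: power2_sum power_mult_distrib sum.distrib sum_distrib_left mult_ac)
    also have "(\<Sum>k = 1..n. (V i k)\<^sup>2) = (\<alpha> i)\<^sup>2"
      by (simp add: L2_set_def \<alpha>_def sum_nonneg)
    finally have "?N\<^sup>2 = (\<alpha> i)\<^sup>2 + 2 * t * ?vh + t\<^sup>2 * ?H" .
    \<comment> \<open>This bounds the increase of the norm by half the increase of its square,
      divided by \<alpha> i; the bound is quadratic in \<open>t\<close>.\<close>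
    moreover have "2 * \<alpha> i * ?N \<le> (\<alpha> i)\<^sup>2 + ?N\<^sup>2"
      using sum_squares_bound[of "\<alpha> i" ?N] by simp
    ultimately have "2 * \<alpha> i * (?N - \<alpha> i) \<le> 2 * t * ?vh + t\<^sup>2 * ?H"
      by (simp add: algebra_simps power2_eq_square)
    then have "?N - \<alpha> i \<le> t * ?vh / \<alpha> i + t\<^sup>2 * ?H / (2 * \<alpha> i)"
      using act by (simp add: field_simps)
    then have "l * (?N - \<alpha> i) \<le> l * (t * ?vh / \<alpha> i + t\<^sup>2 * ?H / (2 * \<alpha> i))"
      using l_pos by (intro mult_left_mono) auto
    then have "t * (\<Sum>k = 1..n. dual i k * h k)
        \<le> t\<^sup>2 * (2 * ?H) + l * (t * ?vh / \<alpha> i + t\<^sup>2 * ?H / (2 * \<alpha> i))"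
      using row_perturbation[OF i, of t h] by (simp flip: sum_distrib_left)
    \<comment> \<open>By the choice of \<open>h\<close>, the linear terms of loss and penalty
      combine to exactly \<open>?H\<close>.\<close>
    moreover have "?H = (\<Sum>k = 1..n. dual i k * h k) - l / \<alpha> i * ?vh"
      by (subst sum_distrib_left, subst sum_subtractf[symmetric], rule sum.cong)
        (auto simp: h_def power2_eq_square algebra_simps)
    ultimately have "t * (?H + l / \<alpha> i * ?vh)
        \<le> t\<^sup>2 * (2 * ?H) + l * (t * ?vh / \<alpha> i + t\<^sup>2 * ?H / (2 * \<alpha> i))"
      by simp
    then show ?thesis by (simp add: algebra_simps)
  qed
  then have "?H \<le> 0" by (rule nonpos_if_linear_le_quadratic)
  then have "?H = 0" by (simp add: antisym sum_nonneg)
  then have "h j = 0" using j by (simp add: sum_nonneg_eq_0_iff)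
  then show ?thesis using act by (simp add: h_def field_simps)
qed

text \<open>On an inactive row both sides vanish, so \<open>V\<close> can be eliminated without
  knowing which rows are active.\<close>

lemma stationarity:
  assumes "i \<in> {1..n}" and "j \<in> {1..n}"
  shows "dual i j * \<alpha> i = l * V i j"
proof (cases "\<alpha> i > 0")
  case False
  then have "\<alpha> i = 0" using \<alpha>_nonneg[of i] by simp
  moreover from this have "V i j = 0" using assms by (simp add: \<alpha>_def L2_set_eq_0_iff)
  ultimately show ?thesis by simp
qed (use assms stationarity_active in blast)

lemma dual_norm_active:
  assumes i: "i \<in> {1..n}" and act: "\<alpha> i > 0"
  shows "(\<Sum>j = 1..n. (dual i j)\<^sup>2) = l\<^sup>2"
proof -
  have "(\<Sum>j = 1..n. (dual i j)\<^sup>2) * (\<alpha> i)\<^sup>2 = (\<Sum>j = 1..n. (l * V i j)\<^sup>2)"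
    using stationarity[OF i] by (simp add: sum_distrib_right flip: power_mult_distrib)
  also have "\<dots> = l\<^sup>2 * (\<alpha> i)\<^sup>2"
    by (simp add: power_mult_distrib \<alpha>_def L2_set_def sum_nonneg flip: sum_distrib_left)
  finally show ?thesis using act by simp
qed

text \<open>From a zero row, moving along the dual vector lowers the loss at rate
  \<open>?G\<^sup>2\<close> and raises the penalty at rate \<open>l * ?G\<close>; optimality forbids
  the first to exceed the second.\<close>

lemma dual_norm_inactive:
  assumes i: "i \<in> {1..n}" and inact: "\<alpha> i = 0"
  shows "(\<Sum>j = 1..n. (dual i j)\<^sup>2) \<le> l\<^sup>2"
proof -
  let ?G = "L2_set (dual i) {1..n}"
  have V0: "V i j = 0" if "j \<in> {1..n}" for j
    using inact that by (simp add: \<alpha>_def L2_set_eq_0_iff)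
  have G2: "?G\<^sup>2 = (\<Sum>j = 1..n. (dual i j)\<^sup>2)" by (simp add: L2_set_def sum_nonneg)
  have "t * (?G\<^sup>2 - l * ?G) \<le> (2 * ?G\<^sup>2) * t\<^sup>2" if "t > 0" for t
  proof -
    have "L2_set (\<lambda>j. V i j + t * dual i j) {1..n} = t * ?G"
      using that V0 by (subst L2_set_right_distrib) (auto intro!: L2_set_cong)
    then show ?thesis
      using row_perturbation[OF i, of t "dual i"] inact G2
      by (simp add: algebra_simps power2_eq_square sum_distrib_left)
  qed
  then have "?G\<^sup>2 - l * ?G \<le> 0" by (rule nonpos_if_linear_le_quadratic)
  then have "?G * (?G - l) \<le> 0" by (simp add: algebra_simps power2_eq_square)
  then have "?G \<le> l" using l_pos L2_set_nonneg[of "dual i" "{1..n}"]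
    by (smt (verit) mult_pos_pos)
  then show ?thesis using G2 L2_set_nonneg[of "dual i" "{1..n}"] by (metis power_mono)
qed

text \<open>Inserting stationarity at (i, j) and (j, i) into the residual eliminates
  \<open>V\<close>. On the diagonal the factor is l + 4 \<alpha> i, split as \<alpha> i + 3 \<alpha>
  i to share its shape with the other entries.\<close>

lemma dual_shrinkage:
  assumes i: "i \<in> {1..n}" and j: "j \<in> {1..n}"
  shows "dual i j * (l + \<alpha> i + (if j = i then 3 * \<alpha> i else \<alpha> j)) = (if j = i then 2 else 1) * l * Y i j"
proof (cases "j = i")
  case True
  then show ?thesis using stationarity[OF i i]
    by (simp add: dual_def residual_def algebra_simps)
next
  case False
  then have "dual i j * \<alpha> j = l * V j i"
    using stationarity[OF j i] residual_sym[OF i j] by (simp add: dual_def)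
  then show ?thesis using False stationarity[OF i j]
    by (simp add: dual_def residual_def algebra_simps)
qed

text \<open>Take \<open>k\<close> with \<alpha> k maximal. The shrinkage factors are at most l +
  \<alpha> k on row \<open>i\<close> and at least that on row \<open>k\<close>, while the dual norm
  is at most \<open>l\<close> on row \<open>i\<close> and equal to \<open>l\<close> on row
  \<open>k\<close>.\<close>

lemma unselected_row_energy_le:
  assumes i: "i \<in> {1..n}" "\<alpha> i = 0" and act: "\<exists>k\<in>{1..n}. \<alpha> k > 0"
  shows "\<exists>k\<in>{1..n}. \<alpha> k > 0 \<and> row_energy 4 n Y i \<le> row_energy 4 n Y k"
proof -
  obtain k where k: "k \<in> {1..n}" and max: "\<And>j. j \<in> {1..n} \<Longrightarrow> \<alpha> j \<le> \<alpha> k"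
  proof -
    have "Max (\<alpha> ` {1..n}) \<in> \<alpha> ` {1..n}" using i by (intro Max_in) auto
    then obtain k where "k \<in> {1..n}" "\<alpha> k = Max (\<alpha> ` {1..n})" by force
    then show ?thesis by (intro that[of k]) auto
  qed
  have k_act: "\<alpha> k > 0" using act max by (meson less_le_trans)
  define q where "q = (l + \<alpha> k)\<^sup>2"
  have q: "q > 0" using l_pos k_act by (simp add: q_def)
  \<comment> \<open>Squaring the diagonal factor 2 of the shrinkage formula produces the weight 4 of
    \<open>row_energy 4\<close>.\<close>
  have weight: "(if j = a then 4 else 1) * (l * Y a j)\<^sup>2 =
      (dual a j)\<^sup>2 * (l + \<alpha> a + (if j = a then 3 * \<alpha> a else \<alpha> j))\<^sup>2"
    if "a \<in> {1..n}" "j \<in> {1..n}" for a j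
  proof -
    have "(if j = a then 4 else 1) * (l * Y a j)\<^sup>2 = ((if j = a then 2 else 1) * l * Y a j)\<^sup>2"
      by (simp add: power_mult_distrib)
    then show ?thesis unfolding dual_shrinkage[OF that, symmetric] power_mult_distrib .
  qed
  have "l\<^sup>2 * row_energy 4 n Y i = (\<Sum>j = 1..n. (if j = i then 4 else 1) * (l * Y i j)\<^sup>2)"
    by (simp add: row_energy_def sum_distrib_left power_mult_distrib mult_ac)
  also have "\<dots> \<le> (\<Sum>j = 1..n. (dual i j)\<^sup>2 * q)"
  proof (rule sum_mono)
    fix j assume j: "j \<in> {1..n}"
    have "(l + \<alpha> i + (if j = i then 3 * \<alpha> i else \<alpha> j))\<^sup>2 \<le> q"
      unfolding q_def using i(2) l_pos max[OF j] \<alpha>_nonneg[of j] by (intro power_mono) auto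
    then show "(if j = i then 4 else 1) * (l * Y i j)\<^sup>2 \<le> (dual i j)\<^sup>2 * q"
      unfolding weight[OF i(1) j] by (intro mult_left_mono) auto
  qed
  also have "\<dots> \<le> l\<^sup>2 * q"
    using dual_norm_inactive[OF i] q by (simp flip: sum_distrib_right)
  also have "\<dots> = (\<Sum>j = 1..n. (dual k j)\<^sup>2 * q)"
    using dual_norm_active[OF k k_act] by (simp flip: sum_distrib_right)
  also have "\<dots> \<le> (\<Sum>j = 1..n. (if j = k then 4 else 1) * (l * Y k j)\<^sup>2)"
  proof (rule sum_mono)
    fix j assume j: "j \<in> {1..n}"
    have "q \<le> (l + \<alpha> k + (if j = k then 3 * \<alpha> k else \<alpha> j))\<^sup>2"
      unfolding q_def using l_pos \<alpha>_nonneg[of j] \<alpha>_nonneg[of k] by (intro power_mono) auto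
    then show "(dual k j)\<^sup>2 * q \<le> (if j = k then 4 else 1) * (l * Y k j)\<^sup>2"
      unfolding weight[OF k j] by (intro mult_left_mono) auto
  qed
  also have "\<dots> = l\<^sup>2 * row_energy 4 n Y k"
    by (simp add: row_energy_def sum_distrib_left power_mult_distrib mult_ac)
  finally show ?thesis using k k_act l_pos by auto
qed

end

subsection \<open>Concentration of weighted Gaussian squares\<close>

text \<open>The left side is the moment generating function at \<open>x\<close> of the square of a
  unit-variance Gaussian with squared mean \<open>b\<close>. The right side keeps the mean 1 + b in
  its linear term and adds a quadratic correction, for both signs of \<open>x\<close>.\<close>

lemma gaussian_square_exponent_le:
  fixes x b :: real
  assumes "\<bar>x\<bar> \<le> 1/4" and "b \<ge> 0"
  shows "exp (x * b / (1 - 2 * x)) / sqrt (1 - 2 * x) \<le> exp ((x + 4 * x\<^sup>2) * (1 + b))"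
proof -
  have pos: "1 - 2 * x > 0" using assms by linarith
  \<comment> \<open>With y = 2x this is ln (1 - y) \<ge> - y - 2 y^2; each sign of \<open>y\<close>
    has its own logarithm bound.\<close>
  have "- (2 * x) - 2 * (2 * x)\<^sup>2 \<le> ln (1 - 2 * x)"
  proof (cases "x \<ge> 0")
    case True
    then show ?thesis
      using ln_one_minus_pos_lower_bound[of "2 * x"] assms by simp
  next
    case False
    then have "- (2 * x) - (2 * x)\<^sup>2 \<le> ln (1 - 2 * x)"
      using ln_one_plus_pos_lower_bound[of "- (2 * x)"] assms by simp
    then show ?thesis by (smt (verit) zero_le_power2)
  qed
  then have "- x - 4 * x\<^sup>2 \<le> ln (sqrt (1 - 2 * x))"
    using pos by (simp add: ln_sqrt power2_eq_square)
  then have "exp (- x - 4 * x\<^sup>2) \<le> sqrt (1 - 2 * x)"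
    using pos by (simp add: ln_ge_iff)
  moreover have "x / (1 - 2 * x) \<le> x + 4 * x\<^sup>2"
  proof -
    \<comment> \<open>This product is the difference of the two sides after clearing the
      denominator; x \<le> 1/4 makes it nonnegative.\<close>
    have "0 \<le> 2 * x\<^sup>2 * (1 - 4 * x)" using assms by (intro mult_nonneg_nonneg) auto
    then have "x \<le> (x + 4 * x\<^sup>2) * (1 - 2 * x)" by (simp add: algebra_simps power2_eq_square)
    then show ?thesis using pos by (simp add: pos_divide_le_eq)
  qed
  then have "exp (x * b / (1 - 2 * x)) \<le> exp ((x + 4 * x\<^sup>2) * b)"
    using mult_right_mono[OF _ \<open>b \<ge> 0\<close>] by fastforce
  ultimately have "exp (x * b / (1 - 2 * x)) / sqrt (1 - 2 * x)
      \<le> exp ((x + 4 * x\<^sup>2) * b) / exp (- x - 4 * x\<^sup>2)"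
    by (intro frac_le) auto
  then show ?thesis by (simp flip: exp_diff add: algebra_simps)
qed

text \<open>Completing the square: tilting a Gaussian density by the exponential of a quadratic
  gives a multiple of another Gaussian density, with variance divided by 1 - 2x.\<close>

lemma exp_square_times_normal_density:
  fixes x b s w :: real
  assumes "x < 1/2" and s: "s > 0"
  shows "normal_density 0 s w * exp (x / s\<^sup>2 * (b + w)\<^sup>2) =
    exp (x * (b\<^sup>2 / s\<^sup>2) / (1 - 2 * x)) / sqrt (1 - 2 * x) *
    normal_density (2 * x * b / (1 - 2 * x)) (s / sqrt (1 - 2 * x)) w"
proof -
  define q where "q = 1 - 2 * x"
  have q: "q > 0" using assms by (simp add: q_def)
  have x: "x = (1 - q) / 2" by (simp add: q_def)
  have "- (w\<^sup>2 / (2 * s\<^sup>2)) + x / s\<^sup>2 * (b + w)\<^sup>2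
      = x * (b\<^sup>2 / s\<^sup>2) / q - (w - 2 * x * b / q)\<^sup>2 / (2 * (s / sqrt q)\<^sup>2)"
    using q s unfolding x by (simp add: power_divide field_simps power2_eq_square)
  moreover have "sqrt (2 * pi * s\<^sup>2) = sqrt q * sqrt (2 * pi * (s / sqrt q)\<^sup>2)"
    using q by (simp add: power_divide flip: real_sqrt_mult)
  ultimately show ?thesis
    using q unfolding normal_density_def q_def[symmetric]
    by (simp add: field_simps flip: exp_add exp_diff exp_minus)
qed

lemma (in prob_space) gaussian_square_mgf:
  fixes x b s :: real
  assumes X: "distributed M lborel X (normal_density 0 s)" and s: "s > 0" and x: "\<bar>x\<bar> \<le> 1/4"
  shows "(\<integral>\<^sup>+\<omega>. ennreal (exp (x / s\<^sup>2 * (b + X \<omega>)\<^sup>2)) \<partial>M)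
    \<le> ennreal (exp ((x + 4 * x\<^sup>2) * (1 + b\<^sup>2 / s\<^sup>2)))"
proof -
  let ?c = "exp (x * (b\<^sup>2 / s\<^sup>2) / (1 - 2 * x)) / sqrt (1 - 2 * x)"
  have q: "1 - 2 * x > 0" using x by linarith
  have "(\<integral>\<^sup>+\<omega>. ennreal (exp (x / s\<^sup>2 * (b + X \<omega>)\<^sup>2)) \<partial>M)
      = (\<integral>\<^sup>+w. ennreal (normal_density 0 s w) * ennreal (exp (x / s\<^sup>2 * (b + w)\<^sup>2)) \<partial>lborel)"
    by (subst distributed_nn_integral[OF X, symmetric]) simp_all
  also have "\<dots> = (\<integral>\<^sup>+w. ennreal ?c *
      ennreal (normal_density (2 * x * b / (1 - 2 * x)) (s / sqrt (1 - 2 * x)) w) \<partial>lborel)"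
    using q s exp_square_times_normal_density[of x s _ b]
    by (intro nn_integral_cong) (simp flip: ennreal_mult'')
  also have "\<dots> = ennreal ?c"
    using q s by (simp add: nn_integral_cmult nn_integral_eq_integral)
  also have "\<dots> \<le> ennreal (exp ((x + 4 * x\<^sup>2) * (1 + b\<^sup>2 / s\<^sup>2)))"
    using gaussian_square_exponent_le[OF x, of "b\<^sup>2 / s\<^sup>2"] by (intro ennreal_leI) simp
  finally show ?thesis .
qed

text \<open>Chernoff's bound. The sign of \<open>x\<close> is left open so that x > 0 yields upper
  tails and x < 0 lower tails.\<close>

lemma (in prob_space) weighted_gaussian_squares_tail:
  fixes x s t :: real and b c :: "'i \<Rightarrow> real"
  assumes I: "finite I" and indep: "indep_vars (\<lambda>_. borel) X I"
    and X: "\<And>i. i \<in> I \<Longrightarrow> distributed M lborel (X i) (normal_density 0 s)"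
    and s: "s > 0" and c: "\<And>i. i \<in> I \<Longrightarrow> \<bar>x * c i\<bar> \<le> 1/4"
  shows "prob {\<omega> \<in> space M. t \<le> x / s\<^sup>2 * (\<Sum>i\<in>I. c i * (b i + X i \<omega>)\<^sup>2)}
    \<le> exp ((\<Sum>i\<in>I. (x * c i + 4 * (x * c i)\<^sup>2) * (1 + (b i)\<^sup>2 / s\<^sup>2)) - t)"
proof -
  let ?Q = "\<lambda>\<omega>. x / s\<^sup>2 * (\<Sum>i\<in>I. c i * (b i + X i \<omega>)\<^sup>2)"
  let ?e = "\<lambda>i. (x * c i + 4 * (x * c i)\<^sup>2) * (1 + (b i)\<^sup>2 / s\<^sup>2)"
  have [measurable]: "X i \<in> borel_measurable M" if "i \<in> I" for i
    using distributed_measurable[OF X[OF that]] by simp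
  have [measurable]: "?Q \<in> borel_measurable M" by measurable
  have "ennreal (prob {\<omega> \<in> space M. t \<le> ?Q \<omega>}) = (\<integral>\<^sup>+\<omega>. indicator {\<omega> \<in> space M. t \<le> ?Q \<omega>} \<omega> \<partial>M)"
    by (simp add: emeasure_eq_measure)
  \<comment> \<open>Exponential Markov inequality, pointwise: the indicator is at most exp (Q - t).
    Working in \<open>ennreal\<close> avoids integrability obligations.\<close>
  also have "\<dots> \<le> (\<integral>\<^sup>+\<omega>. ennreal (exp (- t)) * (\<Prod>i\<in>I. ennreal (exp (x * c i / s\<^sup>2 * (b i + X i \<omega>)\<^sup>2))) \<partial>M)"
  proof (intro nn_integral_mono)
    fix \<omega>
    have "(\<Prod>i\<in>I. ennreal (exp (x * c i / s\<^sup>2 * (b i + X i \<omega>)\<^sup>2))) = ennreal (exp (?Q \<omega>))"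
      using I by (subst prod_ennreal) (simp_all add: exp_sum sum_distrib_left mult_ac)
    then show "indicator {\<omega> \<in> space M. t \<le> ?Q \<omega>} \<omega>
        \<le> ennreal (exp (- t)) * (\<Prod>i\<in>I. ennreal (exp (x * c i / s\<^sup>2 * (b i + X i \<omega>)\<^sup>2)))"
      by (auto simp: indicator_def simp flip: ennreal_mult'' exp_add)
  qed
  also have "\<dots> = ennreal (exp (- t)) * (\<Prod>i\<in>I. \<integral>\<^sup>+\<omega>. ennreal (exp (x * c i / s\<^sup>2 * (b i + X i \<omega>)\<^sup>2)) \<partial>M)"
    using I by (subst nn_integral_cmult, measurable)
      (subst indep_vars_nn_integral, auto intro!: indep_vars_compose2[OF indep])
  also have "\<dots> \<le> ennreal (exp (- t)) * (\<Prod>i\<in>I. ennreal (exp (?e i)))"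
    using gaussian_square_mgf[OF X s c] by (intro mult_left_mono prod_mono_ennreal) auto
  also have "\<dots> = ennreal (exp ((\<Sum>i\<in>I. ?e i) - t))"
    using I by (subst prod_ennreal) (simp_all add: exp_diff exp_minus divide_inverse mult.commute prod_nonneg flip: ennreal_mult'' exp_sum)
  finally show ?thesis by simp
qed

subsection \<open>Row energies of the noisy signal\<close>

lemma symmetric_gaussian_noise_measurable:
  assumes W: "symmetric_gaussian_noise M n s W" and ij: "i \<in> {1..n}" "j \<in> {1..n}"
  shows "W i j \<in> borel_measurable M"
proof -
  have upper: "W a b \<in> borel_measurable M" if "1 \<le> a" "a \<le> b" "b \<le> n" for a b
    using W that distributed_measurable[of M lborel "W a b"]
    unfolding symmetric_gaussian_noise_def by (metis measurable_lborel1)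
  show ?thesis
  proof (cases "i \<le> j")
    case True
    then show ?thesis using ij upper by simp
  next
    case False
    then have "W j i \<in> borel_measurable M" using ij upper by simp
    moreover have "W i j \<omega> = W j i \<omega>" if "\<omega> \<in> space M" for \<omega>
      using W that ij unfolding symmetric_gaussian_noise_def by blast
    ultimately show ?thesis by (simp cong: measurable_cong)
  qed
qed

lemma row_energy_measurable:
  assumes W: "symmetric_gaussian_noise M n s W" and i: "i \<in> {1..n}"
  shows "(\<lambda>\<omega>. row_energy d n (\<lambda>a b. B a b + W a b \<omega>) i) \<in> borel_measurable M"
  unfolding row_energy_def
  by (intro borel_measurable_sum borel_measurable_times borel_measurable_power borel_measurable_add
      borel_measurable_const symmetric_gaussian_noise_measurable[OF W i])

text \<open>The bounds on \<open>d\<close> and \<open>x\<close> keep every product of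
  \<open>x\<close> with a weight below 1/4 in absolute value. As the signal vanishes on the
  diagonal, the weight \<open>d\<close> affects only the pure noise terms.\<close>

lemma row_energy_tail:
  fixes B :: "nat \<Rightarrow> nat \<Rightarrow> real"
  assumes W: "symmetric_gaussian_noise M n s W" and s: "s > 0" and i: "i \<in> {1..n}"
    and sym: "\<And>a b. B a b = B b a" and diag: "B i i = 0"
    and d: "1 \<le> d" "d \<le> 4" and x: "\<bar>x\<bar> \<le> 1/16"
  shows "measure M {\<omega> \<in> space M. t \<le> x / s\<^sup>2 * row_energy d n (\<lambda>a b. B a b + W a b \<omega>) i}
    \<le> exp (x * (real n - 1 + d) + 4 * x\<^sup>2 * (real n - 1 + d\<^sup>2)
          + (x + 4 * x\<^sup>2) * ((\<Sum>j = 1..n. (B i j)\<^sup>2) / s\<^sup>2) - t)"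
proof -
  interpret prob_space M using W by (simp add: symmetric_gaussian_noise_def)
  (* Only the entries on and above the diagonal are independent; f moves row i there. *)
  define f where "f j = (min i j, max i j)" for j
  define I where "I = f ` {1..n}"
  define c where "c p = (if fst p = snd p then d else 1)" for p :: "nat \<times> nat"
  define b where "b p = B (fst p) (snd p)" for p
  define X where "X = (\<lambda>(a, b). W a b)"
  have inj: "inj_on f {1..n}"
    by (auto simp: f_def inj_on_def min_def max_def split: if_splits)
  have I: "I \<subseteq> {(a, b). 1 \<le> a \<and> a \<le> b \<and> b \<le> n}"
    using i by (auto simp: I_def f_def)
  have indep: "indep_vars (\<lambda>_. borel) X I"
    using W unfolding symmetric_gaussian_noise_def X_def by (blast intro: indep_vars_subset[OF _ I])
  have X: "distributed M lborel (X p) (normal_density 0 s)" if "p \<in> I" for p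
    using W I that unfolding symmetric_gaussian_noise_def X_def by auto
  have cf: "c (f j) = (if j = i then d else 1)" for j
    by (auto simp: c_def f_def)
  have bf: "b (f j) = B i j" for j
    using sym by (auto simp: b_def f_def min_def max_def)
  have Xf: "X (f j) \<omega> = W i j \<omega>" if "j \<in> {1..n}" "\<omega> \<in> space M" for j \<omega>
    using W i that unfolding symmetric_gaussian_noise_def X_def f_def min_def max_def by auto
  have energy: "(\<Sum>p\<in>I. c p * (b p + X p \<omega>)\<^sup>2) = row_energy d n (\<lambda>a b. B a b + W a b \<omega>) i"
    if "\<omega> \<in> space M" for \<omega>
    unfolding I_def row_energy_def sum.reindex[OF inj] comp_def
    by (intro sum.cong refl) (simp only: cf bf Xf[OF _ that])
  have small: "\<bar>x * c p\<bar> \<le> 1/4" for p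
  proof -
    have "\<bar>x\<bar> * \<bar>c p\<bar> \<le> 1/16 * 4" using d x by (intro mult_mono) (auto simp: c_def)
    then show ?thesis by (simp add: abs_mult)
  qed
  have expo: "(\<Sum>p\<in>I. (x * c p + 4 * (x * c p)\<^sup>2) * (1 + (b p)\<^sup>2 / s\<^sup>2))
      = x * (real n - 1 + d) + 4 * x\<^sup>2 * (real n - 1 + d\<^sup>2)
          + (x + 4 * x\<^sup>2) * ((\<Sum>j = 1..n. (B i j)\<^sup>2) / s\<^sup>2)"
  proof -
    have weights: "(\<Sum>j = 1..n. if j = i then e else 1) = real n - 1 + e" for e :: real
    proof -
      have "(\<Sum>j = 1..n. if j = i then e else 1) = (\<Sum>j = 1..n. 1 + (if j = i then e - 1 else 0))"
        by (intro sum.cong) auto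
      then show ?thesis using i by (simp add: sum.distrib)
    qed
    have "(\<Sum>p\<in>I. (x * c p + 4 * (x * c p)\<^sup>2) * (1 + (b p)\<^sup>2 / s\<^sup>2))
        = (\<Sum>j = 1..n. x * (if j = i then d else 1) + 4 * x\<^sup>2 * (if j = i then d\<^sup>2 else 1)
            + (x + 4 * x\<^sup>2) / s\<^sup>2 * (B i j)\<^sup>2)"
      unfolding I_def sum.reindex[OF inj] comp_def cf bf
      by (intro sum.cong refl) (auto simp: diag power_mult_distrib add_divide_distrib algebra_simps)
    also have "\<dots> = x * (\<Sum>j = 1..n. if j = i then d else 1) + 4 * x\<^sup>2 * (\<Sum>j = 1..n. if j = i then d\<^sup>2 else 1)
            + (x + 4 * x\<^sup>2) / s\<^sup>2 * (\<Sum>j = 1..n. (B i j)\<^sup>2)"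
      by (simp only: sum.distrib sum_distrib_left)
    finally show ?thesis unfolding weights by simp
  qed
  have "finite I" by (simp add: I_def)
  from weighted_gaussian_squares_tail[where t = t and b = b and c = c, OF this indep X s small]
  show ?thesis unfolding expo by (simp add: energy cong: conj_cong)
qed

text \<open>This \<open>x\<close> is the Chernoff parameter: a deviation of order sqrt (n ln n)
  gains a multiple of ln n in the exponent, and the quadratic term costs only a multiple of ln
  n.\<close>

lemma sqrt_log_scale:
  fixes n :: nat and d :: real
  assumes n: "n \<ge> 15" and d: "1 \<le> d" "d \<le> 4"
  defines "x \<equiv> sqrt (ln n / n)"
  shows "ln (real n) > 0" and "x > 0" and "x * sqrt (n * ln n) = ln n"
    and "4 * x\<^sup>2 * (real n - 1 + d\<^sup>2) \<le> 8 * ln n"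
proof -
  show ln: "ln (real n) > 0" using n by simp
  then show "x > 0" using n by (simp add: x_def)
  have "x * sqrt (n * ln n) = sqrt ((ln n)\<^sup>2)"
    using n by (simp add: x_def power2_eq_square flip: real_sqrt_mult)
  then show "x * sqrt (n * ln n) = ln n" using ln by simp
  have "d\<^sup>2 \<le> 4\<^sup>2" using d by (intro power_mono) auto
  \<comment> \<open>Here n \<ge> 15 gives n - 1 + 16 \<le> 2n.\<close>
  then have "x\<^sup>2 * (real n - 1 + d\<^sup>2) \<le> x\<^sup>2 * (2 * real n)" using n by (intro mult_left_mono) auto
  also have "x\<^sup>2 * (2 * real n) = 2 * ln n" using n ln by (simp add: x_def)
  finally show "4 * x\<^sup>2 * (real n - 1 + d\<^sup>2) \<le> 8 * ln n" by simp
qed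

lemma exp_minus_two_ln:
  fixes y :: real
  assumes "y > 0"
  shows "exp (- 2 * ln y) = 1 / y\<^sup>2"
proof -
  have "exp (- 2 * ln y) = y powr (- 2)" using assms by (simp add: powr_def)
  also have "\<dots> = 1 / y\<^sup>2" using assms by (simp add: powr_minus_divide)
  finally show ?thesis .
qed

text \<open>Meant for the rows of the support. The threshold 3/4 k lies between their signal, at
  most 9/16 k, and that of row m + 1, which is k, both in units of \<open>s\<^sup>2\<close>.\<close>

lemma row_energy_upper_tail:
  fixes B :: "nat \<Rightarrow> nat \<Rightarrow> real"
  assumes W: "symmetric_gaussian_noise M n s W" and s: "s > 0" and i: "i \<in> {1..n}"
    and sym: "\<And>a b. B a b = B b a" and diag: "B i i = 0"
    and d: "1 \<le> d" "d \<le> 4" and n: "n \<ge> 15" "sqrt (ln n / n) \<le> 1/24"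
    and k: "k \<ge> 144 * sqrt (n * ln n)"
    and signal: "(\<Sum>j = 1..n. (B i j)\<^sup>2) \<le> s\<^sup>2 * (9/16 * k)"
  shows "measure M {\<omega> \<in> space M. s\<^sup>2 * (real n - 1 + d + 3/4 * k)
      \<le> row_energy d n (\<lambda>a b. B a b + W a b \<omega>) i} \<le> 1 / (real n)\<^sup>2"
proof -
  define x where "x = sqrt (ln n / n)"
  define R where "R = (\<Sum>j = 1..n. (B i j)\<^sup>2) / s\<^sup>2"
  have x24: "x \<le> 1/24" using n by (simp add: x_def)
  have R: "R \<le> 9/16 * k" using signal s by (simp add: R_def divide_simps mult_ac)
  note scale = sqrt_log_scale[OF n(1) d, folded x_def]
  have kx: "144 * ln n \<le> x * k"
    using mult_left_mono[OF k, of x] scale(2) by (simp only: mult.left_commute[of x] scale(3))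
  \<comment> \<open>The bound x \<le> 1/24 gives 4 x^2 \<le> x/6, hence the factor 7/6.\<close>
  have "(x + 4 * x\<^sup>2) * R \<le> (7/6 * x) * (9/16 * k)"
  proof -
    have "x * x \<le> x * (1/24)" using scale(2) x24 by (intro mult_left_mono) auto
    then have "x + 4 * x\<^sup>2 \<le> 7/6 * x" by (simp add: power2_eq_square)
    then show ?thesis using R scale(2) by (intro mult_mono) (auto simp: R_def sum_nonneg)
  qed
  \<comment> \<open>As 7/6 * 9/16 = 21/32, the margin is 3/32 * x * k \<ge> 13.5 ln n, which covers
    the quadratic noise term 8 ln n and the desired 2 ln n.\<close>
  then have "x * (real n - 1 + d) + 4 * x\<^sup>2 * (real n - 1 + d\<^sup>2) + (x + 4 * x\<^sup>2) * R
      - x * (real n - 1 + d + 3/4 * k) \<le> - 2 * ln n"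
    using scale(1,4) kx by (simp add: algebra_simps)
  then have "exp (x * (real n - 1 + d) + 4 * x\<^sup>2 * (real n - 1 + d\<^sup>2) + (x + 4 * x\<^sup>2) * R
      - x * (real n - 1 + d + 3/4 * k)) \<le> exp (- 2 * ln n)" by simp
  also have "exp (- 2 * ln n) = 1 / (real n)\<^sup>2"
    by (rule exp_minus_two_ln) (use n in simp)
  finally have "exp (x * (real n - 1 + d) + 4 * x\<^sup>2 * (real n - 1 + d\<^sup>2) + (x + 4 * x\<^sup>2) * R
      - x * (real n - 1 + d + 3/4 * k)) \<le> 1 / (real n)\<^sup>2" .
  moreover have "{\<omega> \<in> space M. x * (real n - 1 + d + 3/4 * k)
        \<le> x / s\<^sup>2 * row_energy d n (\<lambda>a b. B a b + W a b \<omega>) i}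
      = {\<omega> \<in> space M. s\<^sup>2 * (real n - 1 + d + 3/4 * k) \<le> row_energy d n (\<lambda>a b. B a b + W a b \<omega>) i}"
    using scale(2) s by (auto simp: pos_le_divide_eq mult_ac)
  ultimately show ?thesis
    using row_energy_tail[where B = B, OF W s i sym diag d, of x "x * (real n - 1 + d + 3/4 * k)"] scale(2) x24
    by (simp add: R_def)
qed

text \<open>Meant for row m + 1: the mirror image with Chernoff parameter -x and the same threshold,
  so that the two tail bounds together separate the rows.\<close>

lemma row_energy_lower_tail:
  fixes B :: "nat \<Rightarrow> nat \<Rightarrow> real"
  assumes W: "symmetric_gaussian_noise M n s W" and s: "s > 0" and i: "i \<in> {1..n}"
    and sym: "\<And>a b. B a b = B b a" and diag: "B i i = 0"
    and d: "1 \<le> d" "d \<le> 4" and n: "n \<ge> 15" "sqrt (ln n / n) \<le> 1/24"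
    and k: "k \<ge> 144 * sqrt (n * ln n)"
    and signal: "s\<^sup>2 * k \<le> (\<Sum>j = 1..n. (B i j)\<^sup>2)"
  shows "measure M {\<omega> \<in> space M. row_energy d n (\<lambda>a b. B a b + W a b \<omega>) i
      \<le> s\<^sup>2 * (real n - 1 + d + 3/4 * k)} \<le> 1 / (real n)\<^sup>2"
proof -
  define x where "x = sqrt (ln n / n)"
  define R where "R = (\<Sum>j = 1..n. (B i j)\<^sup>2) / s\<^sup>2"
  have x24: "x \<le> 1/24" using n by (simp add: x_def)
  have R: "k \<le> R" using signal s by (simp add: R_def divide_simps mult_ac)
  note scale = sqrt_log_scale[OF n(1) d, folded x_def]
  have kx: "144 * ln n \<le> x * k"
    using mult_left_mono[OF k, of x] scale(2) by (simp only: mult.left_commute[of x] scale(3))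
  have "(- x + 4 * x\<^sup>2) * R \<le> - (5/6 * (x * k))"
  proof -
    have "x * x \<le> x * (1/24)" using scale(2) x24 by (intro mult_left_mono) auto
    then have "- x + 4 * x\<^sup>2 \<le> - (5/6 * x)" by (simp add: power2_eq_square)
    then have "(- x + 4 * x\<^sup>2) * R \<le> - (5/6 * x) * R"
      by (intro mult_right_mono) (auto simp: R_def sum_nonneg)
    also have "\<dots> \<le> - (5/6 * (x * k))" using mult_left_mono[OF R, of x] scale(2) by simp
    finally show ?thesis .
  qed
  \<comment> \<open>The margin is 5/6 - 3/4 = 1/12 of x * k, at least 12 ln n because of the
    constant 144; this exceeds 8 ln n + 2 ln n.\<close>
  then have "- x * (real n - 1 + d) + 4 * x\<^sup>2 * (real n - 1 + d\<^sup>2) + (- x + 4 * x\<^sup>2) * R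
      - (- x * (real n - 1 + d + 3/4 * k)) \<le> - 2 * ln n"
    using scale(1,4) kx by (simp add: algebra_simps)
  then have "exp (- x * (real n - 1 + d) + 4 * x\<^sup>2 * (real n - 1 + d\<^sup>2) + (- x + 4 * x\<^sup>2) * R
      - (- x * (real n - 1 + d + 3/4 * k))) \<le> exp (- 2 * ln n)" by simp
  also have "exp (- 2 * ln n) = 1 / (real n)\<^sup>2"
    by (rule exp_minus_two_ln) (use n in simp)
  finally have "exp (- x * (real n - 1 + d) + 4 * x\<^sup>2 * (real n - 1 + d\<^sup>2) + (- x + 4 * x\<^sup>2) * R
      - (- x * (real n - 1 + d + 3/4 * k))) \<le> 1 / (real n)\<^sup>2" .
  moreover have "{\<omega> \<in> space M. - x * (real n - 1 + d + 3/4 * k)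
        \<le> - x / s\<^sup>2 * row_energy d n (\<lambda>a b. B a b + W a b \<omega>) i}
      = {\<omega> \<in> space M. row_energy d n (\<lambda>a b. B a b + W a b \<omega>) i \<le> s\<^sup>2 * (real n - 1 + d + 3/4 * k)}"
    using scale(2) s by (auto simp: pos_divide_le_eq mult_ac)
  ultimately show ?thesis
    using row_energy_tail[where B = B, OF W s i sym diag d, of "- x" "- x * (real n - 1 + d + 3/4 * k)"] scale(2) x24
    by (simp add: R_def)
qed

section \<open>Signal energies of the rows\<close>

lemma signal_matrix_sym: "signal_matrix m b1 b2 i j = signal_matrix m b1 b2 j i"
  by (auto simp: signal_matrix_def)

lemma signal_matrix_diag: "signal_matrix m b1 b2 i i = 0"
  by (auto simp: signal_matrix_def)

lemma signal_row_energy_support: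
  assumes "i \<in> {1..m}" "m + 1 \<le> n"
  shows "(\<Sum>j = 1..n. (signal_matrix m b1 b2 i j)\<^sup>2) \<le> b1\<^sup>2 + real n * b2\<^sup>2"
proof -
  have "(\<Sum>j = 1..n. (signal_matrix m b1 b2 i j)\<^sup>2) \<le> (\<Sum>j = 1..n. (if j = m + 1 then b1\<^sup>2 else 0) + b2\<^sup>2)"
    using assms by (intro sum_mono) (auto simp: signal_matrix_def)
  also have "\<dots> = b1\<^sup>2 + real n * b2\<^sup>2" using assms by (simp add: sum.distrib)
  finally show ?thesis .
qed

lemma signal_row_energy_hub:
  assumes "m + 1 \<le> n"
  shows "(\<Sum>j = 1..n. (signal_matrix m b1 b2 (m + 1) j)\<^sup>2) = real m * b1\<^sup>2"
proof -
  have "(\<Sum>j = 1..n. (signal_matrix m b1 b2 (m + 1) j)\<^sup>2) = (\<Sum>j = 1..m. b1\<^sup>2)"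
    using assms by (intro sum.mono_neutral_cong_right) (auto simp: signal_matrix_def)
  then show ?thesis by simp
qed

section \<open>From row energies to failure of both methods with high probability\<close>

lemma row_energy_cong:
  "(\<And>j. j \<in> {1..n} \<Longrightarrow> Y i j = Z i j) \<Longrightarrow> row_energy d n Y i = row_energy d n Z i"
  by (simp add: row_energy_def)

text \<open>As \<open>S\<close> is nonempty, a solution selecting it has an active row; then some
  row of \<open>S\<close> must have at least the energy of the unselected row
  \<open>i\<close>.\<close>

lemma not_group_lasso_selects:
  assumes sym: "\<And>i j. i \<in> {1..n} \<Longrightarrow> j \<in> {1..n} \<Longrightarrow> Y i j = Y j i"
    and l: "l > 0" and S: "S \<noteq> {}" and i: "i \<in> {1..n} - S"
    and less: "\<And>k. k \<in> S \<Longrightarrow> row_energy 4 n Y k < row_energy 4 n Y i"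
  shows "\<not> group_lasso_selects n l Y S"
proof
  assume "group_lasso_selects n l Y S"
  then obtain V where V: "is_arg_min (group_lasso_objective n l Y) (\<lambda>_. True) V"
    and S_eq: "S = {i \<in> {1..n}. L2_set (V i) {1..n} > 0}"
    by (auto simp: group_lasso_selects_def)
  interpret lasso_solution n l Y V using l sym V by unfold_locales
  have S': "S = {i \<in> {1..n}. \<alpha> i > 0}" using S_eq by (simp add: \<alpha>_def)
  then have "\<alpha> i = 0" using i \<alpha>_nonneg[of i] by auto
  then show False using unselected_row_energy_le[of i] i S less unfolding S' by force
qed

lemma not_hard_threshold_selects:
  assumes "k \<in> S" "i \<in> {1..n} - S" "row_energy 1 n Y k < row_energy 1 n Y i"
  shows "\<not> hard_threshold_selects n m Y S"
proof
  assume "hard_threshold_selects n m Y S"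
  then have "L2_set (Y i) {1..n} \<le> L2_set (Y k) {1..n}"
    using assms by (auto simp: hard_threshold_selects_def)
  then show False using assms by (simp add: row_energy_def L2_set_def)
qed

text \<open>Bound for a fixed \<open>n\<close>: a union bound over the support rows and row m + 1,
  for both diagonal weights. Outside the bad events, \<open>T d\<close> separates the energy of row
  m + 1 from those of the support rows.\<close>

lemma selection_failure_probability:
  fixes M :: "'a measure" and Y :: "'a \<Rightarrow> nat \<Rightarrow> nat \<Rightarrow> real"
  assumes m: "2 \<le> m" "m + 1 \<le> n" and s: "0 < s"
    and W: "symmetric_gaussian_noise M n s W"
    and C: "C2 \<ge> 0" "C1 \<ge> 4 * C2 + 12"
    and b2: "b2 = C2 * s * real n powr (- 1 / 4) * ln (real n) powr (1 / 4)"
    and b1: "b1 \<ge> C1 * s * ((real n * ln (real n)) powr (1 / 4) / sqrt (real m))"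
    and n: "n \<ge> 15" "sqrt (ln n / n) \<le> 1/24"
    and Y: "\<forall>\<omega>\<in>space M. \<forall>i\<in>{1..n}. \<forall>j\<in>{1..n}. Y \<omega> i j = signal_matrix m b1 b2 i j + W i j \<omega>"
  shows "\<exists>A\<in>sets M. (\<forall>\<omega>\<in>A. (\<forall>l>0. \<not> group_lasso_selects n l (Y \<omega>) {1..m}) \<and>
                  \<not> hard_threshold_selects n m (Y \<omega>) {1..m}) \<and> measure M A \<ge> 1 - 2 / n"
proof -
  interpret prob_space M using W by (simp add: symmetric_gaussian_noise_def)
  define B where "B = signal_matrix m b1 b2"
  define L where "L = sqrt (n * ln n)"
  \<comment> \<open>The signal energy of row m + 1 in units of the noise variance.\<close>
  define k where "k = real m * b1\<^sup>2 / s\<^sup>2"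
  define E where "E d i \<omega> = row_energy d n (\<lambda>a b. B a b + W a b \<omega>) i" for d i \<omega>
  define T where "T d = s\<^sup>2 * (real n - 1 + d + 3/4 * k)" for d
  define bad where "bad = (\<lambda>(d, i). {\<omega> \<in> space M. if i = m + 1 then E d i \<omega> \<le> T d else T d \<le> E d i \<omega>})"
  \<comment> \<open>Weight 1 serves hard thresholding, weight 4 the group Lasso.\<close>
  define J where "J = {1, 4 :: real} \<times> {1..m + 1}"
  have ln: "ln (real n) > 0" using n by simp
  have sq: "(y powr (1/4))\<^sup>2 = sqrt y" if "y > 0" for y :: real
    using that by (simp add: power2_eq_square powr_half_sqrt flip: powr_add)
  have L0: "L \<ge> 0" using ln by (simp add: L_def)
  have kL: "C1\<^sup>2 * L \<le> k"
  proof -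
    have "(C1 * s * ((real n * ln (real n)) powr (1 / 4) / sqrt (real m)))\<^sup>2 \<le> b1\<^sup>2"
      using b1 C s by (intro power_mono) auto
    then have "C1\<^sup>2 * s\<^sup>2 * (L / m) \<le> b1\<^sup>2"
      using n ln by (simp add: power_mult_distrib power_divide sq L_def)
    then show ?thesis using s m by (simp add: k_def divide_simps mult_ac)
  qed
  \<comment> \<open>From C1 \<ge> 12 and C1 \<ge> 4 C2: the first meets the noise requirement of the
    tail bounds, the second makes the \<beta>2 part of a support row at most k/16.\<close>
  have C1: "144 \<le> C1\<^sup>2" "16 * C2\<^sup>2 \<le> C1\<^sup>2"
    using power_mono[of 12 C1 2] power_mono[of "4 * C2" C1 2] C by (simp_all add: power_mult_distrib)
  have k144: "144 * sqrt (n * ln n) \<le> k"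
    using kL mult_right_mono[OF C1(1) L0] by (simp add: L_def)
  have b2sq: "real n * b2\<^sup>2 = s\<^sup>2 * (C2\<^sup>2 * L)"
  proof -
    have "real n * (real n powr (- 1 / 4))\<^sup>2 = sqrt (real n)"
      using n by (simp add: powr_minus power_inverse sq real_div_sqrt flip: divide_inverse)
    moreover have "real n * b2\<^sup>2
        = (real n * (real n powr (- 1 / 4))\<^sup>2) * (s\<^sup>2 * C2\<^sup>2 * (ln (real n) powr (1 / 4))\<^sup>2)"
      by (simp add: b2 power_mult_distrib mult_ac)
    ultimately show ?thesis
      using ln by (simp add: sq L_def real_sqrt_mult mult_ac)
  qed
  have support: "(\<Sum>j = 1..n. (B i j)\<^sup>2) \<le> s\<^sup>2 * (9/16 * k)" if "i \<in> {1..m}" for i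
  proof -
    \<comment> \<open>With m \<ge> 2 the single large entry of a support row carries at most half
      the signal energy of row m + 1; 1/2 + 1/16 gives the 9/16 of the upper tail.\<close>
    have "2 * b1\<^sup>2 \<le> real m * b1\<^sup>2" using m by (intro mult_right_mono) auto
    then have "b1\<^sup>2 \<le> s\<^sup>2 * (k / 2)" using s by (simp add: k_def)
    moreover have "C2\<^sup>2 * L \<le> k / 16"
      using kL mult_right_mono[OF C1(2) L0] by simp
    then have "s\<^sup>2 * (C2\<^sup>2 * L) \<le> s\<^sup>2 * (k / 16)" by (intro mult_left_mono) auto
    ultimately show ?thesis
      using signal_row_energy_support[OF that m(2), of b1 b2] b2sq by (simp add: B_def)
  qed
  have hub: "s\<^sup>2 * k \<le> (\<Sum>j = 1..n. (B (m + 1) j)\<^sup>2)"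
    using signal_row_energy_hub[OF m(2)] s by (simp add: B_def k_def)
  have sym: "B a b = B b a" and diag: "B a a = 0" for a b
    by (simp_all add: B_def signal_matrix_diag signal_matrix_sym[of m b1 b2 a b])
  have bad_sets: "bad p \<in> events" if "p \<in> J" for p
  proof -
    obtain d i where [simp]: "p = (d, i)" by (cases p)
    with that m have "i \<in> {1..n}" by (simp add: J_def)
    then have [measurable]: "E d i \<in> borel_measurable M"
      using row_energy_measurable[OF W] by (simp add: E_def[abs_def])
    have "{\<omega> \<in> space M. E d i \<omega> \<le> T d} \<in> events" "{\<omega> \<in> space M. T d \<le> E d i \<omega>} \<in> events"
      by measurable
    then show ?thesis by (simp add: bad_def)
  qed
  have bad_prob: "prob (bad p) \<le> 1 / (real n)\<^sup>2" if p: "p \<in> J" for p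
  proof -
    obtain d i where [simp]: "p = (d, i)" by (cases p)
    from p have d: "1 \<le> d" "d \<le> 4" and i: "i \<in> {1..m + 1}" by (auto simp: J_def)
    from i m have "i \<in> {1..n}" by simp
    note tails = row_energy_upper_tail[where B = B, OF W s this sym diag d n k144]
      row_energy_lower_tail[where B = B, OF W s this sym diag d n k144]
    show ?thesis
    proof (cases "i = m + 1")
      case True
      then show ?thesis using tails(2) hub by (simp add: bad_def E_def T_def)
    next
      case False
      then show ?thesis using tails(1) support[of i] i by (simp add: bad_def E_def T_def)
    qed
  qed
  define A where "A = space M - (\<Union>p\<in>J. bad p)"
  have J: "finite J" "card J = 2 * (m + 1)" by (simp_all add: J_def)
  have U: "(\<Union>p\<in>J. bad p) \<in> events" using J bad_sets by auto
  have "prob (\<Union>p\<in>J. bad p) \<le> (\<Sum>p\<in>J. prob (bad p))"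
    using J bad_sets by (intro finite_measure_subadditive_finite) auto
  also have "\<dots> \<le> real (card J) * (1 / (real n)\<^sup>2)"
    using bad_prob by (intro sum_bounded_above) auto
  \<comment> \<open>There are 2 (m + 1) \<le> 2n events.\<close>
  also have "\<dots> \<le> 2 * real n * (1 / (real n)\<^sup>2)"
    using m J by (intro mult_right_mono) auto
  also have "\<dots> = 2 / n" using n by (simp add: power2_eq_square)
  finally have prob_A: "prob A \<ge> 1 - 2 / n" using U by (simp add: A_def prob_compl)
  have "(\<forall>l>0. \<not> group_lasso_selects n l (Y \<omega>) {1..m}) \<and>
                  \<not> hard_threshold_selects n m (Y \<omega>) {1..m}" if \<omega>: "\<omega> \<in> A" for \<omega>
  proof -
    have sp: "\<omega> \<in> space M" using \<omega> by (simp add: A_def)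
    have E: "E d i \<omega> = row_energy d n (Y \<omega>) i" if "i \<in> {1..n}" for d i
      unfolding E_def using Y sp that by (intro row_energy_cong) (simp add: B_def)
    have less: "row_energy d n (Y \<omega>) i < row_energy d n (Y \<omega>) (m + 1)"
      if "d \<in> {1, 4}" "i \<in> {1..m}" for d i
    proof -
      have "(d, i) \<in> J" "(d, m + 1) \<in> J" using that by (auto simp: J_def)
      then have "\<omega> \<notin> bad (d, i)" "\<omega> \<notin> bad (d, m + 1)" using \<omega> by (auto simp: A_def)
      then have "E d i \<omega> < T d" "T d < E d (m + 1) \<omega>"
        using sp that by (auto simp: bad_def split: if_splits)
      then show ?thesis using that m E by simp
    qed
    have symY: "Y \<omega> i j = Y \<omega> j i" if "i \<in> {1..n}" "j \<in> {1..n}" for i j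
      using Y W sp that unfolding symmetric_gaussian_noise_def by (simp add: signal_matrix_sym[of m b1 b2 i j])
    show ?thesis
      using not_group_lasso_selects[of n "Y \<omega>" _ "{1..m}" "m + 1", OF symY]
        not_hard_threshold_selects[of 1 "{1..m}" "m + 1" n "Y \<omega>" m] less m
      by auto
  qed
  moreover have "A \<in> events" using U by (simp add: A_def)
  ultimately show ?thesis using prob_A by blast
qed

text \<open>Good events are available only for large \<open>n\<close>, whereas the definition asks
  for one at every \<open>n\<close>. The bound by 1 is part of the assumption because
  \<open>M n\<close> is known to be a probability space only eventually.\<close>

lemma with_high_probabilityI:
  assumes ev: "eventually (\<lambda>n. \<exists>A\<in>sets (M n). (\<forall>\<omega>\<in>A. P n \<omega>) \<and>
      b n \<le> measure (M n) A \<and> measure (M n) A \<le> 1) sequentially"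
    and lim: "b \<longlonglongrightarrow> 1"
  shows "with_high_probability M P"
proof -
  define good where "good n A \<longleftrightarrow> A \<in> sets (M n) \<and> (\<forall>\<omega>\<in>A. P n \<omega>) \<and>
      b n \<le> measure (M n) A \<and> measure (M n) A \<le> 1" for n A
  define A where "A n = (if \<exists>A. good n A then SOME A. good n A else {})" for n
  have A: "good n (A n)" if "\<exists>A. good n A" for n
    using someI_ex[OF that] that by (simp add: A_def)
  have "A n \<in> sets (M n) \<and> (\<forall>\<omega>\<in>A n. P n \<omega>)" for n
  proof (cases "\<exists>A. good n A")
    case True
    from A[OF this] show ?thesis by (simp add: good_def)
  next
    case False
    then show ?thesis by (simp add: A_def)
  qed
  moreover from ev have "eventually (\<lambda>n. \<exists>A. good n A) sequentially"
    by (simp add: good_def Bex_def)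
  then have "eventually (\<lambda>n. good n (A n)) sequentially"
    by (rule eventually_mono) (rule A)
  then have "eventually (\<lambda>n. b n \<le> measure (M n) (A n)) sequentially"
    "eventually (\<lambda>n. measure (M n) (A n) \<le> 1) sequentially"
    by (auto simp: good_def elim: eventually_mono)
  then have "(\<lambda>n. measure (M n) (A n)) \<longlonglongrightarrow> 1"
    by (rule tendsto_sandwich[OF _ _ lim tendsto_const])
  ultimately show ?thesis unfolding with_high_probability_def by blast
qed

theorem theorem14:
  shows "\<exists>c2>0. \<forall>C2\<ge>c2. \<exists>c1>0. \<forall>C1\<ge>c1.
    \<forall>(M :: nat \<Rightarrow> 'a measure) (W :: nat \<Rightarrow> nat \<Rightarrow> nat \<Rightarrow> 'a \<Rightarrow> real)
     (m :: nat \<Rightarrow> nat) (\<sigma> :: nat \<Rightarrow> real) (\<beta>1 :: nat \<Rightarrow> real) (\<beta>2 :: nat \<Rightarrow> real)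
     (Y :: nat \<Rightarrow> 'a \<Rightarrow> nat \<Rightarrow> nat \<Rightarrow> real).
      (\<forall>\<^sub>F n in sequentially.
         2 \<le> m n \<and> m n + 1 \<le> n \<and> 0 < \<sigma> n \<and>
         symmetric_gaussian_noise (M n) n (\<sigma> n) (W n) \<and>
         \<beta>2 n = C2 * \<sigma> n * real n powr (- 1 / 4) * ln (real n) powr (1 / 4) \<and>
         \<beta>1 n \<ge> C1 * \<sigma> n * ((real n * ln (real n)) powr (1 / 4) / sqrt (real (m n))) \<and>
         (\<forall>\<omega>\<in>space (M n). \<forall>i\<in>{1..n}. \<forall>j\<in>{1..n}.
            Y n \<omega> i j = signal_matrix (m n) (\<beta>1 n) (\<beta>2 n) i j + W n i j \<omega>))
      \<longrightarrow> with_high_probability M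
           (\<lambda>n \<omega>. (\<forall>l>0. \<not> group_lasso_selects n l (Y n \<omega>) {1..m n}) \<and>
                  \<not> hard_threshold_selects n (m n) (Y n \<omega>) {1..m n})"
proof (rule exI[of _ 1], intro conjI allI impI, goal_cases)
  case (2 C2)
  show ?case
  \<comment> \<open>The threshold for \<open>C1\<close> may depend on \<open>C2\<close>: row m + 1
    has to dominate the \<beta>2 entries of the support rows as well as the noise.\<close>
  proof (rule exI[of _ "4 * C2 + 12"], intro conjI allI impI, goal_cases)
    case (2 C1 M W m \<sigma> \<beta>1 \<beta>2 Y)
    have "eventually (\<lambda>n. sqrt (ln (real n) / real n) \<le> 1/24) sequentially"
      by real_asymp
    then have "eventually (\<lambda>n. \<exists>A\<in>sets (M n). (\<forall>\<omega>\<in>A. (\<forall>l>0. \<not> group_lasso_selects n l (Y n \<omega>) {1..m n}) \<and>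
                    \<not> hard_threshold_selects n (m n) (Y n \<omega>) {1..m n}) \<and>
        1 - 2 / real n \<le> measure (M n) A \<and> measure (M n) A \<le> 1) sequentially"
      using 2(2) eventually_ge_at_top[of 15]
    proof eventually_elim
      case (elim n)
      then have "prob_space (M n)" by (simp add: symmetric_gaussian_noise_def)
      then show ?case
        using selection_failure_probability[of "m n" n "\<sigma> n" "M n" "W n" C2 C1 "\<beta>2 n" "\<beta>1 n" "Y n"]
          elim \<open>1 \<le> C2\<close> 2(1) prob_space.prob_le_1[of "M n"] by auto
    qed
    then show ?case by (rule with_high_probabilityI) real_asymp
  qed (use 2 in auto)
qed auto

end
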